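(* Let $\mathcal{H}$ be a complex Hilbert space, let $T$ be a bounded linear operator on $\mathcal{H}$, and suppose that $\mathcal{N}(T^* )\subseteq\mathcal{N}(T)$. Let $T=V|T|$ be the canonical polar decomposition of $T$, and let $n\in\mathbb{N}$. Then the $n$-th iterate of the mean transform of $T$ is $$\widehat{T}^{(n)}=\frac{1}{2^n}\,V\Big(\sum_{j=0}^{n}\binom{n}{j}(V^* )^j|T|V^j\Big).$$
   Context: Here $\mathbb{N}=\{0,1,2,\dots\}$ and $\mathcal{N}(\cdot)$ denotes the null space. For a bounded operator $T$, $|T|:=(T^*T)^{1/2}$, and the canonical polar decomposition is $T=V|T|$ where $V$ is the partial isometry with $\mathcal{N}(V)=\mathcal{N}(T)$. The mean transform of $T$ is $\widehat{T}:=\frac12(V|T|+|T|V)$, where $T=V|T|$ is the canonical polar decomposition. Its iterates are $\widehat{T}^{(0)}:=T$ and $\widehat{T}^{(n+1)}:=\widehat{\widehat{T}^{(n)}}$, i.e. the mean transform of $\widehat{T}^{(n)}$. *)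

theory Defs
  imports "HOL-Analysis.Analysis"
begin

(* The inner product is linear in its first argument and conjugate-linear in the second. *)
class complex_inner = real_normed_vector +
  fixes scaleC :: "complex \<Rightarrow> 'a \<Rightarrow> 'a" (infixr "*\<^sub>C" 75)
    and cinner :: "'a \<Rightarrow> 'a \<Rightarrow> complex"
  assumes scaleC_add_right: "c *\<^sub>C (x + y) = c *\<^sub>C x + c *\<^sub>C y"
    and scaleC_add_left: "(c + d) *\<^sub>C x = c *\<^sub>C x + d *\<^sub>C x"
    and scaleC_scaleC: "c *\<^sub>C d *\<^sub>C x = (c * d) *\<^sub>C x"
    and scaleR_scaleC: "r *\<^sub>R x = complex_of_real r *\<^sub>C x"
    and cinner_commute: "cinner x y = cnj (cinner y x)"
    and cinner_add_left: "cinner (x + y) z = cinner x z + cinner y z"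
    and cinner_scaleC_left: "cinner (c *\<^sub>C x) y = c * cinner x y"
    and cinner_norm: "cinner x x = complex_of_real ((norm x)\<^sup>2)"

class chilbert_space = complex_inner + complete_space

subclass (in chilbert_space) banach ..

definition bounded_clinear ::
    "('a::complex_inner \<Rightarrow> 'b::complex_inner) \<Rightarrow> bool" where
  "bounded_clinear T \<longleftrightarrow> bounded_linear T \<and> (\<forall>c x. T (c *\<^sub>C x) = c *\<^sub>C T x)"

definition null_space :: "('a \<Rightarrow> 'b::zero) \<Rightarrow> 'a set" where
  "null_space T = {x. T x = 0}"

(* Well defined for bounded operators on a Hilbert space, by the Riesz representation theorem. *)
definition cadjoint ::
    "('a::chilbert_space \<Rightarrow> 'b::chilbert_space) \<Rightarrow> 'b \<Rightarrow> 'a" where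
  "cadjoint T = (THE S. \<forall>x y. cinner (T x) y = cinner x (S y))"

definition positive_op :: "('a::complex_inner \<Rightarrow> 'a) \<Rightarrow> bool" where
  "positive_op P \<longleftrightarrow> bounded_clinear P \<and> (\<forall>x. cinner (P x) x \<in> \<real>\<^sub>\<ge>\<^sub>0)"

(* A positive operator has exactly one positive square root. *)
definition op_sqrt :: "('a::chilbert_space \<Rightarrow> 'a) \<Rightarrow> 'a \<Rightarrow> 'a" where
  "op_sqrt P = (THE S. positive_op S \<and> S \<circ> S = P)"

definition op_abs :: "('a::chilbert_space \<Rightarrow> 'a) \<Rightarrow> 'a \<Rightarrow> 'a" where
  "op_abs T = op_sqrt (cadjoint T \<circ> T)"

(* Isometric on the orthogonal complement of the null space. *)
definition partial_isometry :: "('a::complex_inner \<Rightarrow> 'b::complex_inner) \<Rightarrow> bool" where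
  "partial_isometry V \<longleftrightarrow> bounded_clinear V \<and>
     (\<forall>x. (\<forall>y\<in>null_space V. cinner x y = 0) \<longrightarrow> norm (V x) = norm x)"

definition polar_decomposition ::
    "('a::chilbert_space \<Rightarrow> 'a) \<Rightarrow> ('a \<Rightarrow> 'a) \<Rightarrow> bool" where
  "polar_decomposition T V \<longleftrightarrow>
     partial_isometry V \<and> T = V \<circ> op_abs T \<and> null_space V = null_space T"

(* Each bounded T has exactly one V with polar_decomposition T V. *)
definition mean_transform :: "('a::chilbert_space \<Rightarrow> 'a) \<Rightarrow> 'a \<Rightarrow> 'a" where
  "mean_transform T = (let V = (THE V. polar_decomposition T V) in
     (\<lambda>x. (1/2) *\<^sub>R (V (op_abs T x) + op_abs T (V x))))"

end

(* Write V' for the adjoint of V and put A_n = 2^-n sum_j (n choose j) V'^j |T| V^j. Each A_n is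
   positive with N(A_n) = N(V), so V' V A_n = A_n and V A_n is itself a canonical polar
   decomposition: |V A_n| = A_n. Since N(V') = N(T') is contained in N(T) = N(V), the final space
   of V contains its initial space, so V V' A_n = A_n and A_n V = V (V' A_n V). The mean transform
   of V A_n is therefore V (A_n + V' A_n V) / 2 = V A_(n+1) by Pascal's rule. *)
theory Submission
  imports Defs
begin

section \<open>Complex inner product spaces\<close>

text \<open>Adjoint, square root and polar factor are given by definite descriptions, so each
  becomes usable only once its defining property is known to have exactly one solution. For square
  roots this is done without functional calculus: existence comes from a norm-convergent iteration,
  uniqueness from the growth of operator powers. The invariant N(A_n) = N(V) survives each step
  because the quadratic forms of positive operators are nonnegative, so a sum of two of them kills a
  vector only if both summands do. Most estimates use the real part of the inner product, which is
  symmetric and real linear in both arguments; complex linearity of the operators gives back the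
  complex identities.\<close>

definition rinner :: "'a::complex_inner \<Rightarrow> 'a \<Rightarrow> real" where
  "rinner x y = Re (cinner x y)"

lemma cinner_add_right: "cinner x (y + z) = cinner x y + cinner x (z::'a::complex_inner)"
  by (metis cinner_commute cinner_add_left complex_cnj_add)

lemma cinner_scaleR_left: "cinner (r *\<^sub>R x) y = complex_of_real r * cinner x (y::'a::complex_inner)"
  by (simp add: scaleR_scaleC cinner_scaleC_left)

lemma cinner_scaleR_right: "cinner x (r *\<^sub>R y) = complex_of_real r * cinner x (y::'a::complex_inner)"
  by (metis cinner_commute cinner_scaleR_left complex_cnj_complex_of_real complex_cnj_mult)

lemma rinner_commute: "rinner x y = rinner y x"
  unfolding rinner_def by (subst cinner_commute) simp

lemma rinner_self: "rinner x x = (norm x)\<^sup>2"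
  by (simp add: rinner_def cinner_norm)

lemma linear_rinner_left: "linear (\<lambda>x. rinner x y)"
  by (intro linearI) (simp_all add: rinner_def cinner_add_left cinner_scaleR_left)

lemma linear_rinner_right: "linear (\<lambda>y. rinner x y)"
  by (intro linearI) (simp_all add: rinner_def cinner_add_right cinner_scaleR_right)

lemmas rinner_simps =
  linear_add[OF linear_rinner_left] linear_add[OF linear_rinner_right]
  linear_diff[OF linear_rinner_left] linear_diff[OF linear_rinner_right]
  linear_scale[OF linear_rinner_left] linear_scale[OF linear_rinner_right]
  linear_neg[OF linear_rinner_left] linear_neg[OF linear_rinner_right]
  linear_0[OF linear_rinner_left] linear_0[OF linear_rinner_right]

lemma norm_add_squared: "(norm (x + y))\<^sup>2 = (norm x)\<^sup>2 + 2 * rinner x y + (norm y)\<^sup>2"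
  using rinner_commute[of x y] by (simp add: rinner_self[symmetric] rinner_simps)

lemma norm_diff_squared: "(norm (x - y))\<^sup>2 = (norm x)\<^sup>2 - 2 * rinner x y + (norm y)\<^sup>2"
  using rinner_commute[of x y] by (simp add: rinner_self[symmetric] rinner_simps)

lemma rinner_le_norm: "rinner x y \<le> norm x * norm y"
proof (cases "x = 0 \<or> y = 0")
  case True
  then show ?thesis by (auto simp: rinner_simps)
next
  case False
  then have pos: "norm x * norm y > 0" by simp
  \<comment> \<open>The weights make the squared norm a multiple of \<open>norm x * norm y\<close>,
    which is positive and can be cancelled.\<close>
  have "0 \<le> (norm (norm y *\<^sub>R x - norm x *\<^sub>R y))\<^sup>2" by simp
  also have "\<dots> = 2 * (norm x * norm y) * (norm x * norm y - rinner x y)"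
    by (simp add: norm_diff_squared rinner_simps power_mult_distrib) (simp add: power2_eq_square algebra_simps)
  finally show ?thesis using pos by (simp add: zero_le_mult_iff)
qed

lemma abs_rinner_le_norm: "\<bar>rinner x y\<bar> \<le> norm x * norm y"
  using rinner_le_norm[of x y] rinner_le_norm[of "- x" y] by (simp add: rinner_simps abs_le_iff)

lemma bounded_bilinear_rinner: "bounded_bilinear rinner"
  by standard (auto simp: rinner_simps intro!: exI[of _ 1] abs_rinner_le_norm)

lemma rinner_eqI: "(\<And>z. rinner z x = rinner z y) \<Longrightarrow> x = y"
  using rinner_self[of "x - y"] rinner_simps(4)[of "x - y" x y] by simp

section \<open>Bounded complex-linear operators\<close>

lemma bounded_clinearD:
  assumes "bounded_clinear T"
  shows "bounded_linear T" "linear T" "T (c *\<^sub>C x) = c *\<^sub>C T x"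
  using assms by (auto simp: bounded_clinear_def bounded_linear.linear)

lemmas bounded_clinear_simps =
  linear_add[OF bounded_clinearD(2)] linear_diff[OF bounded_clinearD(2)]
  linear_scale[OF bounded_clinearD(2)] linear_0[OF bounded_clinearD(2)]
  linear_neg[OF bounded_clinearD(2)]

lemma bounded_clinear_compose:
  "bounded_clinear S \<Longrightarrow> bounded_clinear T \<Longrightarrow> bounded_clinear (\<lambda>x. S (T x))"
  by (simp add: bounded_clinear_def bounded_linear_compose)

lemma bounded_clinear_add:
  "bounded_clinear S \<Longrightarrow> bounded_clinear T \<Longrightarrow> bounded_clinear (\<lambda>x. S x + T x)"
  by (simp add: bounded_clinear_def bounded_linear_add scaleC_add_right)

lemma scaleC_minus_right: "c *\<^sub>C (x - y) = c *\<^sub>C x - c *\<^sub>C (y::'a::complex_inner)"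
  using scaleC_add_right[of c "x - y" y] by simp

lemma bounded_clinear_diff:
  "bounded_clinear S \<Longrightarrow> bounded_clinear T \<Longrightarrow> bounded_clinear (\<lambda>x. S x - T x)"
  by (simp add: bounded_clinear_def bounded_linear_sub scaleC_minus_right)

lemma bounded_clinear_scaleR:
  "bounded_clinear S \<Longrightarrow> bounded_clinear (\<lambda>x. r *\<^sub>R S x)"
  unfolding bounded_clinear_def
  by (simp add: bounded_linear_const_scaleR) (simp add: scaleR_scaleC scaleC_scaleC mult.commute)

lemma bounded_clinear_ident: "bounded_clinear (\<lambda>x. x)"
  by (simp add: bounded_clinear_def)

lemma bounded_clinear_bound:
  assumes "bounded_clinear T"
  obtains M where "M > 0" "\<And>x. norm (T x) \<le> M * norm x"
  using bounded_linear.pos_bounded[OF bounded_clinearD(1)[OF assms]] by (metis mult.commute)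

(* The imaginary parts are recovered by replacing x with -i x. *)
lemma cinner_eq_if_rinner_eq:
  assumes "bounded_clinear T" "\<And>x. rinner (T x) y = rinner x z"
  shows "cinner (T x) y = cinner x z"
proof (rule complex_eqI)
  show "Re (cinner (T x) y) = Re (cinner x z)"
    using assms(2) by (simp add: rinner_def)
  have "rinner (T ((- \<i>) *\<^sub>C x)) y = rinner ((- \<i>) *\<^sub>C x) z" by (rule assms(2))
  then show "Im (cinner (T x) y) = Im (cinner x z)"
    by (simp add: rinner_def bounded_clinearD(3)[OF assms(1)] cinner_scaleC_left)
qed

text \<open>Continuity of complex scaling follows from \<open>cinner_norm\<close>; it carries
  complex homogeneity over to limits of operators.\<close>

lemma bounded_linear_scaleC: "bounded_linear (\<lambda>x::'a::complex_inner. c *\<^sub>C x)"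
proof (rule bounded_linear_intro[where K = "cmod c"])
  fix x :: 'a
  have "cinner (c *\<^sub>C x) (c *\<^sub>C x) = c * cnj c * cinner x x"
    by (metis cinner_commute cinner_scaleC_left complex_cnj_mult mult.assoc)
  then have "complex_of_real ((norm (c *\<^sub>C x))\<^sup>2) = complex_of_real ((cmod c)\<^sup>2 * (norm x)\<^sup>2)"
    by (simp only: cinner_norm complex_norm_square of_real_mult)
  then have "(norm (c *\<^sub>C x))\<^sup>2 = (norm x * cmod c)\<^sup>2"
    by (simp only: of_real_eq_iff power_mult_distrib mult.commute)
  then show "norm (c *\<^sub>C x) \<le> norm x * cmod c"
    by (simp add: power2_eq_iff_nonneg)
qed (simp_all add: scaleC_add_right scaleR_scaleC scaleC_scaleC mult.commute)

section \<open>Riesz representation and adjoints\<close>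

(* The representing vector minimises the functional |x|^2 - 2 f x; minimising sequences are Cauchy
   by the parallelogram law. *)
lemma riesz_representation:
  fixes f :: "'a::chilbert_space \<Rightarrow> real"
  assumes "bounded_linear f"
  obtains z where "\<And>x. f x = rinner x z"
proof -
  interpret f: bounded_linear f by (rule assms)
  obtain K where K: "\<And>x. norm (f x) \<le> norm x * K" using f.bounded by blast
  define J where "J x = (norm x)\<^sup>2 - 2 * f x" for x
  have lower: "J x \<ge> - K\<^sup>2" for x
  proof -
    have "0 \<le> (norm x - K)\<^sup>2" by simp
    then show ?thesis using K[of x] unfolding J_def power2_diff by simp
  qed
  define m where "m = (INF x. J x)"
  have bdd: "bdd_below (range J)" using lower by (auto intro!: bdd_belowI)
  have m: "m \<le> J x" for x unfolding m_def by (rule cINF_lower[OF bdd]) simp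
  have "\<exists>x. J x < m + 1 / real (Suc n)" for n
    using cINF_less_iff[of UNIV J "m + 1 / real (Suc n)"] bdd unfolding m_def by auto
  then obtain X where X: "\<And>n. J (X n) < m + 1 / real (Suc n)" by metis
  \<comment> \<open>The linear terms cancel in the parallelogram identity, leaving \<open>J\<close>
    at the midpoint, where it is at least \<open>m\<close>.\<close>
  have par: "(norm (x - y))\<^sup>2 \<le> 2 * J x + 2 * J y - 4 * m" for x y
  proof -
    have "(norm (x - y))\<^sup>2 = 2 * J x + 2 * J y - 4 * J ((1/2) *\<^sub>R (x + y))"
      by (simp add: J_def norm_diff_squared norm_add_squared power_mult_distrib power_divide
          f.add f.scaleR rinner_simps field_simps)
    then show ?thesis using m[of "(1/2) *\<^sub>R (x + y)"] by linarith
  qed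
  have "Cauchy X"
  proof (rule metric_CauchyI)
    fix e :: real assume "e > 0"
    \<comment> \<open>Two values of \<open>J\<close> within e^2/4 of \<open>m\<close> make the bound
      in \<open>par\<close> less than e^2.\<close>
    then obtain N where N: "1 / real (Suc N) < e\<^sup>2 / 4"
      using nat_approx_posE[of "e\<^sup>2 / 4"] by auto
    have near: "J (X i) < m + e\<^sup>2 / 4" if "i \<ge> N" for i
    proof -
      have "1 / real (Suc i) \<le> 1 / real (Suc N)" using that by (intro divide_left_mono) auto
      then show ?thesis using X[of i] N by linarith
    qed
    have "dist (X i) (X j) < e" if "i \<ge> N" "j \<ge> N" for i j
    proof -
      have "(norm (X i - X j))\<^sup>2 < e\<^sup>2"
        using par[of "X i" "X j"] near[OF that(1)] near[OF that(2)] by linarith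
      then show ?thesis using \<open>e > 0\<close> by (simp add: dist_norm power_less_imp_less_base)
    qed
    then show "\<exists>M. \<forall>i\<ge>M. \<forall>j\<ge>M. dist (X i) (X j) < e" by blast
  qed
  then obtain z where z: "X \<longlonglongrightarrow> z" using Cauchy_convergent convergent_def by blast
  have "(\<lambda>n. J (X n)) \<longlonglongrightarrow> J z"
    unfolding J_def by (intro tendsto_intros f.tendsto z)
  moreover have "(\<lambda>n. m + 1 / real (Suc n)) \<longlonglongrightarrow> m + 0"
    using LIMSEQ_Suc[OF lim_1_over_n] by (intro tendsto_intros) simp
  ultimately have "J z \<le> m + 0"
    using X by (intro LIMSEQ_le) (auto intro: less_imp_le)
  then have min: "J z \<le> J x" for x using m[of x] by simp
  have "f v = rinner v z" for v
  proof (cases "v = 0")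
    case True
    then show ?thesis by (simp add: f.zero rinner_simps)
  next
    case False
    define d where "d = rinner z v - f v"
    \<comment> \<open>This \<open>t\<close> minimises the quadratic J z + 2 t d + t^2 |v|^2.\<close>
    define t where "t = - d / (norm v)\<^sup>2"
    have "J (z + t *\<^sub>R v) = J z + 2 * t * d + t\<^sup>2 * (norm v)\<^sup>2"
      by (simp add: J_def norm_add_squared f.add f.scaleR rinner_simps d_def
          power_mult_distrib algebra_simps)
    also have "\<dots> = J z - d\<^sup>2 / (norm v)\<^sup>2"
      using False by (simp add: t_def power2_eq_square field_simps)
    finally have "d\<^sup>2 / (norm v)\<^sup>2 \<le> 0" using min[of "z + t *\<^sub>R v"] by linarith
    then have "d = 0" using False by (simp add: divide_le_0_iff)
    then show ?thesis by (simp add: d_def rinner_commute)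
  qed
  then show ?thesis by (rule that)
qed

text \<open>Riesz representation of the real functional \<open>rinner (T x) y\<close> suffices for
  existence, since \<open>cinner_eq_if_rinner_eq\<close> restores the imaginary part.\<close>

lemma cinner_cadjoint:
  assumes "bounded_clinear T"
  shows "cinner (T x) y = cinner x (cadjoint T y)"
proof -
  have "\<exists>z. \<forall>x. cinner (T x) y = cinner x z" for y
  proof -
    have "bounded_linear (\<lambda>x. rinner (T x) y)"
      using bounded_linear_compose[OF
          bounded_bilinear.bounded_linear_left[OF bounded_bilinear_rinner]
          bounded_clinearD(1)[OF assms]] .
    then obtain z where "\<And>x. rinner (T x) y = rinner x z" by (rule riesz_representation) blast
    then show ?thesis using cinner_eq_if_rinner_eq[OF assms] by blast
  qed
  then obtain S where S: "\<forall>x y. cinner (T x) y = cinner x (S y)" by metis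
  have "cadjoint T = S"
    unfolding cadjoint_def
  proof (rule the_equality)
    fix R assume R: "\<forall>x y. cinner (T x) y = cinner x (R y)"
    show "R = S"
      by (intro ext rinner_eqI) (metis R S rinner_def)
  qed (rule S)
  then show ?thesis using S by blast
qed

lemma rinner_cadjoint:
  "bounded_clinear T \<Longrightarrow> rinner x (cadjoint T y) = rinner (T x) y"
  by (simp add: rinner_def cinner_cadjoint)

lemma rinner_cadjoint_left:
  "bounded_clinear T \<Longrightarrow> rinner (cadjoint T y) x = rinner y (T x)"
  by (metis rinner_cadjoint rinner_commute)

lemma cadjoint_eqI:
  assumes "bounded_clinear T" "\<And>x y. rinner (T x) y = rinner x (S y)"
  shows "cadjoint T = S"
  by (intro ext rinner_eqI) (simp add: rinner_cadjoint assms)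

text \<open>A bound M for T also bounds its adjoint T', because |T' y|^2 = <T T' y, y> \<le> M |T'
  y| |y|.\<close>

lemma bounded_clinear_cadjoint:
  assumes T: "bounded_clinear T"
  shows "bounded_clinear (cadjoint T)"
proof -
  obtain M where M: "M > 0" "\<And>x. norm (T x) \<le> M * norm x"
    using T by (rule bounded_clinear_bound) blast
  have bound: "norm (cadjoint T y) \<le> norm y * M" for y
  proof -
    let ?z = "cadjoint T y"
    have "norm ?z * norm ?z = rinner (T ?z) y"
      by (simp add: power2_eq_square rinner_cadjoint[OF T, symmetric] rinner_self)
    also have "\<dots> \<le> norm (T ?z) * norm y" by (rule rinner_le_norm)
    also have "\<dots> \<le> (M * norm ?z) * norm y" by (intro mult_right_mono M) simp
    finally have "norm ?z * norm ?z \<le> norm ?z * (norm y * M)" by (simp add: mult_ac)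
    then show ?thesis using M(1) by (cases "norm ?z = 0") auto
  qed
  have "bounded_linear (cadjoint T)"
    by (rule bounded_linear_intro[OF _ _ bound]; rule rinner_eqI)
      (simp_all add: rinner_cadjoint[OF T] rinner_simps)
  moreover have "cadjoint T (c *\<^sub>C y) = c *\<^sub>C cadjoint T y" for c y
  proof (rule rinner_eqI)
    fix x
    have "cinner x (c *\<^sub>C w) = cnj c * cinner x w" for x w :: 'a
      by (metis cinner_commute cinner_scaleC_left complex_cnj_mult)
    moreover have "cinner x (c *\<^sub>C w) = cnj c * cinner x w" for x w :: 'b
      by (metis cinner_commute cinner_scaleC_left complex_cnj_mult)
    ultimately show "rinner x (cadjoint T (c *\<^sub>C y)) = rinner x (c *\<^sub>C cadjoint T y)"
      by (simp add: rinner_def cinner_cadjoint[OF T, symmetric])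
  qed
  ultimately show ?thesis by (simp add: bounded_clinear_def)
qed

section \<open>Positive operators and their square roots\<close>

lemma positive_opD:
  assumes "positive_op P"
  shows "bounded_clinear P" "rinner (P x) x \<ge> 0"
  using assms by (auto simp: positive_op_def rinner_def complex_nonneg_Reals_iff)

(* Polarisation: a sesquilinear form vanishing on the diagonal is zero. *)
lemma positive_op_selfadjoint:
  assumes "positive_op P"
  shows "rinner (P x) y = rinner x (P y)"
proof -
  note P = positive_opD(1)[OF assms]
  have Im0: "Im (cinner (P x) x) = 0" for x
    using assms by (auto simp: positive_op_def complex_nonneg_Reals_iff)
  have ci: "cinner x (c *\<^sub>C w) = cnj c * cinner x w" for x w :: 'a and c
    by (metis cinner_commute cinner_scaleC_left complex_cnj_mult)
  have "Im (cinner (P (x + \<i> *\<^sub>C y)) (x + \<i> *\<^sub>C y)) = 0" by (rule Im0)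
  then have "Re (cinner (P y) x) = Re (cinner (P x) y)"
    using Im0[of x] Im0[of y]
    by (simp add: bounded_clinear_simps[OF P] bounded_clinearD(3)[OF P]
        cinner_add_left cinner_add_right cinner_scaleC_left ci)
  then show ?thesis by (metis rinner_def rinner_commute)
qed

text \<open>Real symmetry lifts to the complex form, so \<open>cinner (P x) x\<close> equals its own
  conjugate.\<close>

lemma positive_opI:
  assumes "bounded_clinear P" "\<And>x y. rinner (P x) y = rinner x (P y)" "\<And>x. rinner (P x) x \<ge> 0"
  shows "positive_op P"
proof -
  have "cinner (P x) x = cnj (cinner (P x) x)" for x
    using cinner_eq_if_rinner_eq[OF assms(1), of x "P x"] assms(2) cinner_commute[of x "P x"] by simp
  then have "Im (cinner (P x) x) = 0" for x by (simp add: complex_eq_iff)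
  then show ?thesis using assms by (simp add: positive_op_def rinner_def complex_nonneg_Reals_iff)
qed

text \<open>This is P^2 \<le> M P, proved from positivity at x - P x / M alone, since it serves
  later to construct square roots.\<close>

lemma positive_op_norm_squared_le:
  assumes P: "positive_op P" and M: "M > 0" "\<And>x. norm (P x) \<le> M * norm x"
  shows "(norm (P x))\<^sup>2 \<le> M * rinner (P x) x"
proof -
  note bc = positive_opD(1)[OF P]
  have "0 \<le> rinner (P (x - (1/M) *\<^sub>R P x)) (x - (1/M) *\<^sub>R P x)" by (rule positive_opD(2)[OF P])
  also have "\<dots> = rinner (P x) x - 2 / M * (norm (P x))\<^sup>2 + (1/M)\<^sup>2 * rinner (P (P x)) (P x)"
    using positive_op_selfadjoint[OF P, of "P x" x]
    by (simp add: bounded_clinear_simps[OF bc] rinner_simps rinner_self power2_eq_square algebra_simps)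
  also have "\<dots> \<le> rinner (P x) x - 2 / M * (norm (P x))\<^sup>2 + (1/M)\<^sup>2 * (M * (norm (P x))\<^sup>2)"
  proof -
    have "rinner (P (P x)) (P x) \<le> norm (P (P x)) * norm (P x)" by (rule rinner_le_norm)
    also have "\<dots> \<le> (M * norm (P x)) * norm (P x)" by (intro mult_right_mono M) simp
    finally show ?thesis by (intro add_left_mono mult_left_mono) (simp_all add: power2_eq_square)
  qed
  also have "\<dots> = rinner (P x) x - (norm (P x))\<^sup>2 / M"
    using M(1) by (simp add: power2_eq_square field_simps)
  finally show ?thesis using M(1) by (simp add: field_simps)
qed

lemma positive_op_eq_0:
  assumes "positive_op P" "rinner (P x) x = 0"
  shows "P x = 0"
proof -
  obtain M where "M > 0" "\<And>x. norm (P x) \<le> M * norm x"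
    using positive_opD(1)[OF assms(1)] by (rule bounded_clinear_bound) blast
  from positive_op_norm_squared_le[OF assms(1) this, of x] assms(2) show ?thesis by simp
qed

lemma positive_op_scaleR:
  assumes "positive_op P" "r \<ge> 0"
  shows "positive_op (\<lambda>x. r *\<^sub>R P x)"
  by (rule positive_opI)
    (simp_all add: bounded_clinear_scaleR positive_opD[OF assms(1)] assms(2) rinner_simps
      positive_op_selfadjoint[OF assms(1), symmetric])

lemma positive_op_add:
  assumes "positive_op P" "positive_op Q"
  shows "positive_op (\<lambda>x. P x + Q x)"
  by (rule positive_opI)
    (simp_all add: bounded_clinear_add positive_opD[OF assms(1)] positive_opD[OF assms(2)]
      rinner_simps positive_op_selfadjoint[OF assms(1), symmetric]
      positive_op_selfadjoint[OF assms(2), symmetric])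

text \<open>P^2 \<le> P bounds |x - P x|^2 by |x|^2 - <P x, x>.\<close>

lemma norm_diff_positive_contraction:
  assumes P: "positive_op P" and "\<And>x. norm (P x) \<le> norm x"
  shows "norm (x - P x) \<le> norm x"
proof -
  have "(norm (P x))\<^sup>2 \<le> rinner (P x) x"
    using positive_op_norm_squared_le[OF P, of 1 x] assms(2) by simp
  then have "(norm (x - P x))\<^sup>2 \<le> (norm x)\<^sup>2"
    using positive_opD(2)[OF P, of x] by (simp add: norm_diff_squared rinner_commute)
  then show ?thesis by (rule power2_le_imp_le) simp
qed

(* The fixed points of Y = (X + Y^2) / 2 satisfy (1 - Y)^2 = 1 - X. *)
primrec sqrt_iter :: "('a::real_normed_vector \<Rightarrow>\<^sub>L 'a) \<Rightarrow> nat \<Rightarrow> 'a \<Rightarrow>\<^sub>L 'a" where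
  "sqrt_iter X 0 = 0"
| "sqrt_iter X (Suc n) = (1/2) *\<^sub>R (X + (sqrt_iter X n o\<^sub>L sqrt_iter X n))"

text \<open>The scalar iteration for X = 1. It dominates both the norms and the increments of
  \<open>sqrt_iter X\<close> when \<open>norm X \<le> 1\<close>.\<close>

primrec sqrt_majorant :: "nat \<Rightarrow> real" where
  "sqrt_majorant 0 = 0"
| "sqrt_majorant (Suc n) = (1 + (sqrt_majorant n)\<^sup>2) / 2"

lemma sqrt_majorant_bounds: "0 \<le> sqrt_majorant n" "sqrt_majorant n \<le> 1"
proof -
  have "0 \<le> sqrt_majorant n \<and> sqrt_majorant n \<le> 1"
  proof (induction n)
    case (Suc n)
    then show ?case using power_le_one[of "sqrt_majorant n" 2] by simp
  qed simp
  then show "0 \<le> sqrt_majorant n" "sqrt_majorant n \<le> 1" by auto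
qed

text \<open>The iterated map need not be a strict contraction on the unit ball. Summability of the
  increments comes instead from the majorant, whose increments telescope and which is monotone and
  bounded by 1.\<close>

lemma sqrt_iter_convergent:
  fixes X :: "'a::banach \<Rightarrow>\<^sub>L 'a"
  assumes X: "norm X \<le> 1"
  shows "convergent (sqrt_iter X)" "norm (sqrt_iter X n) \<le> 1"
proof -
  let ?Y = "sqrt_iter X" and ?y = sqrt_majorant
  have normY: "norm (?Y n) \<le> ?y n" for n
  proof (induction n)
    case (Suc n)
    have "norm (X + (?Y n o\<^sub>L ?Y n)) \<le> norm X + norm (?Y n) * norm (?Y n)"
      using norm_triangle_ineq[of X "?Y n o\<^sub>L ?Y n"] norm_blinfun_compose[of "?Y n" "?Y n"] by linarith
    also have "\<dots> \<le> 1 + ?y n * ?y n"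
      by (intro add_mono X mult_mono Suc sqrt_majorant_bounds norm_ge_zero)
    finally show ?case by (simp add: power2_eq_square)
  qed simp
  then show "norm (?Y n) \<le> 1" using sqrt_majorant_bounds(2)[of n] order_trans by blast
  have step: "norm (?Y (Suc n) - ?Y n) \<le> ?y (Suc n) - ?y n" for n
  proof (induction n)
    case 0
    then show ?case using X by simp
  next
    case (Suc n)
    let ?D = "?Y (Suc n) - ?Y n"
    have half: "(1/2) *\<^sub>R (X + A) - (1/2) *\<^sub>R (X + B) = (1/2) *\<^sub>R (A - B)" for A B
      by (simp add: scaleR_diff_right[symmetric])
    have "?Y (Suc (Suc n)) - ?Y (Suc n) =
        (1/2) *\<^sub>R (X + (?Y (Suc n) o\<^sub>L ?Y (Suc n))) - (1/2) *\<^sub>R (X + (?Y n o\<^sub>L ?Y n))"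
      by (simp only: sqrt_iter.simps(2))
    also have "\<dots> = (1/2) *\<^sub>R ((?Y (Suc n) o\<^sub>L ?Y (Suc n)) - (?Y n o\<^sub>L ?Y n))"
      by (rule half)
    \<comment> \<open>A factorisation of a difference of squares that needs no
      commutativity.\<close>
    also have "(?Y (Suc n) o\<^sub>L ?Y (Suc n)) - (?Y n o\<^sub>L ?Y n) = (?Y (Suc n) o\<^sub>L ?D) + (?D o\<^sub>L ?Y n)"
      by (simp only: bounded_bilinear.diff_left[OF bounded_bilinear_blinfun_compose]
          bounded_bilinear.diff_right[OF bounded_bilinear_blinfun_compose]) simp
    finally have "norm (?Y (Suc (Suc n)) - ?Y (Suc n)) = (1/2) * norm ((?Y (Suc n) o\<^sub>L ?D) + (?D o\<^sub>L ?Y n))"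
      by simp
    also have "\<dots> \<le> (1/2) * (norm (?Y (Suc n)) * norm ?D + norm ?D * norm (?Y n))"
      by (intro mult_left_mono order_trans[OF norm_triangle_ineq] add_mono norm_blinfun_compose) simp
    also have "\<dots> \<le> (1/2) * (?y (Suc n) * (?y (Suc n) - ?y n) + (?y (Suc n) - ?y n) * ?y n)"
      by (intro mult_left_mono add_mono mult_mono normY Suc sqrt_majorant_bounds norm_ge_zero
          order_trans[OF norm_ge_zero Suc]) simp
    also have "\<dots> = ((?y (Suc n))\<^sup>2 - (?y n)\<^sup>2) / 2"
      by (simp add: power2_eq_square algebra_simps del: sqrt_majorant.simps)
    also have "\<dots> = ?y (Suc (Suc n)) - ?y (Suc n)"
      by (simp only: sqrt_majorant.simps(2)) (simp add: field_simps)
    finally show ?case .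
  qed
  have "incseq ?y"
    using order_trans[OF norm_ge_zero step] by (intro incseq_SucI) (simp only: diff_ge_0_iff_ge)
  then obtain l where "?y \<longlonglongrightarrow> l"
    using incseq_convergent[of ?y 1] sqrt_majorant_bounds(2) by blast
  then have "summable (\<lambda>n. ?y (Suc n) - ?y n)" by (rule telescope_summable)
  then have "summable (\<lambda>n. ?Y (Suc n) - ?Y n)"
    using step by (rule summable_comparison_test'[where N = 0])
  then have "(\<lambda>n. \<Sum>i<n. ?Y (Suc i) - ?Y i) \<longlonglongrightarrow> (\<Sum>n. ?Y (Suc n) - ?Y n)"
    by (rule summable_LIMSEQ)
  then show "convergent ?Y"
    unfolding sum_lessThan_telescope by (auto simp: convergent_def)
qed

text \<open>Scaling to Q = P / M makes X = 1 - Q a contraction. The limit Y of the iteration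
  satisfies (1 - Y)^2 = Q, so S = sqrt M (1 - Y), which is positive because
  \<open>norm Y \<le> 1\<close>.\<close>

lemma positive_op_sqrt_exists:
  fixes P :: "'a::chilbert_space \<Rightarrow> 'a"
  assumes P: "positive_op P"
  obtains S where "positive_op S" "S \<circ> S = P"
proof -
  note bc = positive_opD(1)[OF P]
  obtain M where M: "M > 0" "\<And>x. norm (P x) \<le> M * norm x"
    using bc by (rule bounded_clinear_bound) blast
  define Q where "Q = (\<lambda>x. (1/M) *\<^sub>R P x)"
  have Q: "positive_op Q" unfolding Q_def using P M(1) by (intro positive_op_scaleR) auto
  have "norm (Q x) \<le> norm x" for x using M by (simp add: Q_def field_simps)
  note contr = norm_diff_positive_contraction[OF Q this]
  have bcX: "bounded_clinear (\<lambda>x. x - Q x)"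
    by (intro bounded_clinear_diff bounded_clinear_ident positive_opD(1)[OF Q])
  define X where "X = Blinfun (\<lambda>x. x - Q x)"
  have X: "blinfun_apply X x = x - Q x" for x
    unfolding X_def by (simp add: bounded_linear_Blinfun_apply bounded_clinearD(1)[OF bcX])
  have normX: "norm X \<le> 1" by (rule norm_blinfun_bound) (use contr in \<open>auto simp: X\<close>)
  obtain Y where lim: "sqrt_iter X \<longlonglongrightarrow> Y"
    using sqrt_iter_convergent(1)[OF normX] by (auto simp: convergent_def)
  have limx: "(\<lambda>n. blinfun_apply (sqrt_iter X n) x) \<longlonglongrightarrow> blinfun_apply Y x" for x
    by (intro blinfun.tendsto lim tendsto_const)
  have "norm Y \<le> 1"
    using lim sqrt_iter_convergent(2)[OF normX] by (intro LIMSEQ_le_const2[OF tendsto_norm]) auto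
  have "(\<lambda>n. sqrt_iter X (Suc n)) \<longlonglongrightarrow> (1/2) *\<^sub>R (X + (Y o\<^sub>L Y))"
    unfolding sqrt_iter.simps
    by (intro tendsto_intros bounded_bilinear.tendsto[OF bounded_bilinear_blinfun_compose] lim)
  then have Yeq: "Y = (1/2) *\<^sub>R (X + (Y o\<^sub>L Y))"
    using LIMSEQ_unique LIMSEQ_Suc[OF lim] by blast
  have YY: "2 *\<^sub>R blinfun_apply Y x = x - Q x + Y (Y x)" for x
  proof -
    have "blinfun_apply Y x = (1/2) *\<^sub>R (x - Q x + Y (Y x))"
      using arg_cong[OF Yeq, of "\<lambda>Z. blinfun_apply Z x"]
      by (simp only: blinfun.scaleR_left blinfun.add_left blinfun_apply_blinfun_compose X)
    then show ?thesis by (metis scaleR_half_double scaleR_2 scaleR_add_right)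
  qed
  \<comment> \<open>Bounded linear functions are only real linear as a type, so complex homogeneity
    is proved for the iterates and passed to the limit.\<close>
  have iterC: "blinfun_apply (sqrt_iter X n) (c *\<^sub>C x) = c *\<^sub>C sqrt_iter X n x" for n c x
  proof (induction n arbitrary: x)
    case 0
    then show ?case using scaleC_minus_right[of c x x]
      by (simp add: blinfun.zero_left scaleC_minus_right[of c "0::'a" 0, simplified])
  next
    case (Suc n)
    then show ?case
      by (simp add: blinfun.add_left blinfun.scaleR_left bounded_clinearD(3)[OF bcX] X
          scaleC_add_right scaleR_scaleC scaleC_scaleC mult.commute del: of_real_divide)
  qed
  have YC: "blinfun_apply Y (c *\<^sub>C x) = c *\<^sub>C Y x" for c x
    using LIMSEQ_unique[OF limx[of "c *\<^sub>C x"]] bounded_linear.tendsto[OF bounded_linear_scaleC limx]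
    by (simp add: iterC)
  have iterS: "rinner (sqrt_iter X n x) y = rinner x (sqrt_iter X n y)" for n x y
  proof (induction n arbitrary: x y)
    case (Suc n)
    then show ?case
      by (simp add: blinfun.add_left blinfun.scaleR_left X rinner_simps positive_op_selfadjoint[OF Q])
  qed (simp add: rinner_simps)
  have YS: "rinner (Y x) y = rinner x (Y y)" for x y
    using LIMSEQ_unique[OF bounded_bilinear.tendsto[OF bounded_bilinear_rinner limx tendsto_const]]
      bounded_bilinear.tendsto[OF bounded_bilinear_rinner tendsto_const limx]
    by (simp add: iterS)
  define S where "S = (\<lambda>x. sqrt M *\<^sub>R (x - Y x))"
  have bcS: "bounded_clinear S"
    unfolding S_def
    by (intro bounded_clinear_scaleR bounded_clinear_diff bounded_clinear_ident)
      (simp add: bounded_clinear_def YC blinfun.bounded_linear_right)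
  have "positive_op S"
  proof (rule positive_opI[OF bcS])
    show "rinner (S x) y = rinner x (S y)" for x y
      by (simp add: S_def rinner_simps YS)
    have "rinner (Y x) x \<le> (norm x)\<^sup>2" for x
    proof -
      have "rinner (Y x) x \<le> norm (Y x) * norm x" by (rule rinner_le_norm)
      also have "norm (Y x) \<le> norm x"
        using order_trans[OF norm_blinfun[of Y x]] \<open>norm Y \<le> 1\<close> mult_right_mono[of "norm Y" 1 "norm x"] by simp
      finally show ?thesis by (simp add: power2_eq_square mult_right_mono)
    qed
    then show "rinner (S x) x \<ge> 0" for x
      using M(1) by (simp add: S_def rinner_simps rinner_self)
  qed
  moreover have "S \<circ> S = P"
  proof
    fix x
    have "(S \<circ> S) x = M *\<^sub>R (x - Y x - (Y x - Y (Y x)))"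
      using M(1) by (simp add: S_def blinfun.diff_right blinfun.scaleR_right scaleR_diff_right[symmetric])
    also have "x - Y x - (Y x - Y (Y x)) = Q x" using YY[of x] by (simp add: algebra_simps scaleR_2)
    also have "M *\<^sub>R Q x = P x" using M(1) by (simp add: Q_def)
    finally show "(S \<circ> S) x = P x" .
  qed
  ultimately show ?thesis by (rule that)
qed

(* Bernoulli's inequality for the operator 1 + E. *)
lemma positive_op_power_growth:
  assumes E: "positive_op E"
  shows "(norm (((\<lambda>z. z + E z) ^^ m) z))\<^sup>2 \<ge> (norm z)\<^sup>2 + 2 * real m * rinner (E z) z"
proof -
  note bc = positive_opD(1)[OF E]
  let ?L = "\<lambda>z. z + E z"
  \<comment> \<open>The form of E never decreases under 1 + E, so every step adds at least twice its
    initial value to the squared norm.\<close>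
  have mono: "rinner (E (?L z)) (?L z) \<ge> rinner (E z) z" for z
  proof -
    have "rinner (E (?L z)) (?L z) = rinner (E z) z + 2 * rinner (E z) (E z) + rinner (E (E z)) (E z)"
      using positive_op_selfadjoint[OF E, of "E z" z]
      by (simp add: bounded_clinear_simps[OF bc] rinner_simps)
    then show ?thesis using positive_opD(2)[OF E, of "E z"] by (simp add: rinner_self)
  qed
  have "rinner (E ((?L ^^ m) z)) ((?L ^^ m) z) \<ge> rinner (E z) z \<and>
    (norm ((?L ^^ m) z))\<^sup>2 \<ge> (norm z)\<^sup>2 + 2 * real m * rinner (E z) z"
  proof (induction m)
    case (Suc m)
    let ?w = "(?L ^^ m) z"
    have "(norm (?L ?w))\<^sup>2 \<ge> (norm ?w)\<^sup>2 + 2 * rinner (E ?w) ?w"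
      by (simp add: norm_add_squared rinner_commute)
    then show ?case using Suc mono[of ?w] by (simp add: algebra_simps)
  qed simp
  then show ?thesis by blast
qed

(* D = S - R anticommutes with K = S + R, so (1 + K)^m D = D (1 - K)^m stays bounded in m (after
   scaling K to a contraction), whereas it grows linearly unless K D = 0. *)
lemma positive_op_sqrt_unique:
  assumes S: "positive_op S" and R: "positive_op R" and eq: "S \<circ> S = R \<circ> R"
  shows "S = R"
proof
  fix x
  note bS = positive_opD(1)[OF S] and bR = positive_opD(1)[OF R]
  have SS: "S (S z) = R (R z)" for z using eq by (metis comp_apply)
  define K where "K = (\<lambda>z. S z + R z)"
  define D where "D = (\<lambda>z. S z - R z)"
  have K: "positive_op K" unfolding K_def by (rule positive_op_add[OF S R])
  have bD: "bounded_clinear D" unfolding D_def by (rule bounded_clinear_diff[OF bS bR])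
  obtain M where M: "M > 0" "\<And>x. norm (K x) \<le> M * norm x"
    using positive_opD(1)[OF K] by (rule bounded_clinear_bound) blast
  obtain N where N: "N > 0" "\<And>x. norm (D x) \<le> N * norm x"
    using bD by (rule bounded_clinear_bound) blast
  define E where "E = (\<lambda>z. (1/M) *\<^sub>R K z)"
  have E: "positive_op E" unfolding E_def using K M(1) by (intro positive_op_scaleR) auto
  have "norm (E x) \<le> norm x" for x using M by (simp add: E_def field_simps)
  note contr = norm_diff_positive_contraction[OF E this]
  have anti: "D z + E (D z) = D (z - E z)" for z
  proof -
    \<comment> \<open>The squares cancel, and both sides become R S z - S R z.\<close>
    have "K (D z) = - D (K z)"
      by (simp add: K_def D_def bounded_clinear_simps[OF bS] bounded_clinear_simps[OF bR] SS)
    then show ?thesis by (simp add: E_def bounded_clinear_simps[OF bD])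
  qed
  have pow: "((\<lambda>z. z + E z) ^^ m) (D x) = D (((\<lambda>z. z - E z) ^^ m) x)" for m
    by (induction m) (simp_all add: anti)
  have powG: "norm (((\<lambda>z. z - E z) ^^ m) x) \<le> norm x" for m
    by (induction m) (use contr order_trans in auto)
  have bound: "2 * real m * rinner (E (D x)) (D x) \<le> (N * norm x)\<^sup>2" for m
  proof -
    have "norm (((\<lambda>z. z + E z) ^^ m) (D x)) \<le> N * norm x"
      unfolding pow using order_trans[OF N(2) mult_left_mono[OF powG]] N(1) by simp
    then have "(norm (((\<lambda>z. z + E z) ^^ m) (D x)))\<^sup>2 \<le> (N * norm x)\<^sup>2"
      by (intro power_mono) auto
    then show ?thesis
      using positive_op_power_growth[OF E, of "D x" m] zero_le_power2[of "norm (D x)"] by linarith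
  qed
  have "rinner (E (D x)) (D x) = 0"
  proof (rule ccontr)
    assume "rinner (E (D x)) (D x) \<noteq> 0"
    then have "rinner (E (D x)) (D x) > 0" using positive_opD(2)[OF E, of "D x"] by linarith
    then obtain m where "real m * rinner (E (D x)) (D x) > (N * norm x)\<^sup>2"
      using reals_Archimedean3 by blast
    then show False using bound[of m] zero_le_power2[of "N * norm x"] by linarith
  qed
  then have "rinner (S (D x)) (D x) + rinner (R (D x)) (D x) = 0"
    using M(1) by (simp add: E_def K_def rinner_simps)
  \<comment> \<open>Both terms are nonnegative. Hence S and R kill D x, so D (D x) = 0, and symmetry
    of D turns this into |D x|^2 = 0.\<close>
  then have "rinner (S (D x)) (D x) = 0" "rinner (R (D x)) (D x) = 0"
    using positive_opD(2)[OF S, of "D x"] positive_opD(2)[OF R, of "D x"] by linarith+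
  then have "D (D x) = 0"
    using positive_op_eq_0[OF S, of "D x"] positive_op_eq_0[OF R, of "D x"]
    by (subst D_def) simp
  moreover have "rinner (D x) (D x) = rinner (D (D x)) x"
    by (simp add: D_def rinner_simps positive_op_selfadjoint[OF S] positive_op_selfadjoint[OF R]
      bounded_clinear_simps[OF bS] bounded_clinear_simps[OF bR])
  ultimately have "D x = 0" by (simp add: rinner_simps rinner_self)
  then show "S x = R x" by (simp add: D_def)
qed

section \<open>The absolute value of an operator\<close>

lemma op_sqrt_eqI:
  assumes "positive_op S" "S \<circ> S = P"
  shows "op_sqrt P = S"
  unfolding op_sqrt_def
proof (rule the_equality)
  fix R assume "positive_op R \<and> R \<circ> R = P"
  then have "positive_op R" "R \<circ> R = S \<circ> S" by (auto simp only: assms(2))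
  then show "R = S" by (rule positive_op_sqrt_unique[OF _ assms(1)])
qed (intro conjI assms)

lemma op_abs_properties:
  assumes T: "bounded_clinear T"
  shows "positive_op (op_abs T)" "op_abs T \<circ> op_abs T = cadjoint T \<circ> T"
proof -
  have "positive_op (\<lambda>x. cadjoint T (T x))"
  proof (rule positive_opI)
    show "bounded_clinear (\<lambda>x. cadjoint T (T x))"
      by (rule bounded_clinear_compose[OF bounded_clinear_cadjoint[OF T] T])
    show "rinner (cadjoint T (T x)) y = rinner x (cadjoint T (T y))" for x y
      by (simp only: rinner_cadjoint[OF T] rinner_cadjoint_left[OF T])
    show "rinner (cadjoint T (T x)) x \<ge> 0" for x
      by (simp only: rinner_cadjoint_left[OF T] rinner_self zero_le_power2)
  qed
  then obtain S where S: "positive_op S" "S \<circ> S = (\<lambda>x. cadjoint T (T x))"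
    by (rule positive_op_sqrt_exists) blast
  then have "op_abs T = S"
    unfolding op_abs_def comp_def[of "cadjoint T"] by (rule op_sqrt_eqI)
  then show "positive_op (op_abs T)" "op_abs T \<circ> op_abs T = cadjoint T \<circ> T"
    using S by (simp_all only: comp_def[of "cadjoint T"])
qed

text \<open>T and |T| send each vector to vectors of equal norm.\<close>

lemma null_space_op_abs:
  assumes T: "bounded_clinear T"
  shows "null_space (op_abs T) = null_space T"
proof -
  have "(norm (op_abs T x))\<^sup>2 = (norm (T x))\<^sup>2" for x
  proof -
    have "(norm (op_abs T x))\<^sup>2 = rinner (op_abs T (op_abs T x)) x"
      by (simp add: rinner_self positive_op_selfadjoint[OF op_abs_properties(1)[OF T]])
    also have "\<dots> = rinner (cadjoint T (T x)) x"
      using fun_cong[OF op_abs_properties(2)[OF T], of x] by simp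
    finally show ?thesis by (simp add: rinner_cadjoint_left[OF T] rinner_self)
  qed
  then have "op_abs T x = 0 \<longleftrightarrow> T x = 0" for x
    by (metis norm_eq_zero zero_eq_power2)
  then show ?thesis by (simp add: null_space_def)
qed

section \<open>Polar decompositions\<close>

lemma partial_isometryD: "partial_isometry V \<Longrightarrow> bounded_clinear V"
  by (simp add: partial_isometry_def)

text \<open>Let V' be the adjoint and y = V' V x - x. Then x, y and x + y are orthogonal to N(V), so
  V preserves their norms and hence <x, y>. But <y, y> = <V x, V y> - <x, y>, which is therefore
  0.\<close>

lemma partial_isometry_cadjoint_cancel:
  assumes V: "partial_isometry V" and x: "\<And>y. V y = 0 \<Longrightarrow> rinner x y = 0"
  shows "cadjoint V (V x) = x"
proof -
  note bV = partial_isometryD[OF V]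
  have iso: "norm (V z) = norm z" if z: "\<And>y. V y = 0 \<Longrightarrow> rinner z y = 0" for z
  proof -
    \<comment> \<open>N(V) is closed under multiplication by i, so real orthogonality to it implies
      complex orthogonality.\<close>
    have "cinner z y = 0" if "V y = 0" for y
    proof -
      have "V (\<i> *\<^sub>C y) = 0"
        using that bounded_clinearD(3)[OF bV, of \<i> y] scaleC_minus_right[of \<i> "0::'b" 0] by simp
      then have "rinner z (\<i> *\<^sub>C y) = 0" by (rule z)
      moreover have "cinner z (\<i> *\<^sub>C y) = - \<i> * cinner z y"
        by (metis cinner_commute cinner_scaleC_left complex_cnj_mult complex_cnj_i)
      ultimately show ?thesis using z[OF that] by (simp add: rinner_def complex_eq_iff)
    qed
    then show ?thesis using V by (auto simp: partial_isometry_def null_space_def)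
  qed
  define y where "y = cadjoint V (V x) - x"
  have y: "rinner y w = 0" if "V w = 0" for w
    using that x by (simp add: y_def rinner_simps rinner_cadjoint_left[OF bV])
  have "norm (V (x + y)) = norm (x + y)" by (rule iso) (simp add: rinner_simps x y)
  then have "(norm (V x + V y))\<^sup>2 = (norm (x + y))\<^sup>2" by (simp add: bounded_clinear_simps[OF bV])
  then have "rinner (V x) (V y) = rinner x y"
    using iso[OF x] iso[OF y] by (simp add: norm_add_squared)
  moreover have "rinner y w = rinner (V x) (V w) - rinner x w" for w
    by (simp add: y_def rinner_simps rinner_cadjoint_left[OF bV])
  ultimately have "rinner y y = 0" by simp
  then show ?thesis by (simp add: rinner_self y_def)
qed

(* For the difference D of two such partial isometries, the range of the adjoint of D lies in
   N(|S|), on which D vanishes. Hence D times its adjoint is 0. *)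
lemma polar_decomposition_unique:
  assumes S: "bounded_clinear S" and V: "polar_decomposition S V" and W: "polar_decomposition S W"
  shows "V = W"
proof -
  note A = op_abs_properties(1)[OF S]
  define D where "D = (\<lambda>x. V x - W x)"
  have bD: "bounded_clinear D"
    unfolding D_def using V W
    by (intro bounded_clinear_diff partial_isometryD) (auto simp: polar_decomposition_def)
  have DA: "D (op_abs S x) = 0" for x
    using V W unfolding D_def polar_decomposition_def by (metis comp_apply diff_self)
  have "cadjoint D y = 0" for y
  proof -
    let ?z = "cadjoint D y"
    have "op_abs S ?z = 0"
      by (rule rinner_eqI)
        (simp add: positive_op_selfadjoint[OF A, symmetric] rinner_cadjoint[OF bD] DA rinner_simps)
    then have "?z \<in> null_space S"
      using null_space_op_abs[OF S] by (auto simp: null_space_def)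
    then have "?z \<in> null_space V" "?z \<in> null_space W"
      using V W unfolding polar_decomposition_def by blast+
    then have "D ?z = 0" by (simp only: D_def null_space_def mem_Collect_eq diff_self)
    then have "rinner ?z ?z = 0" by (simp add: rinner_cadjoint[OF bD] rinner_simps)
    then show ?thesis by (simp add: rinner_self)
  qed
  then have "D x = 0" for x
    using rinner_cadjoint[OF bD, of x "D x"] by (simp add: rinner_simps rinner_self)
  then show ?thesis by (auto simp: D_def)
qed

text \<open>The range of a symmetric A is orthogonal to N(A), which here is N(V).\<close>

lemma partial_isometry_cadjoint_cancel_positive:
  assumes V: "partial_isometry V" and A: "positive_op A" and null: "null_space A = null_space V"
  shows "cadjoint V (V (A x)) = A x"
proof (rule partial_isometry_cadjoint_cancel[OF V])
  fix y assume "V y = 0"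
  then have "A y = 0" using null by (auto simp: null_space_def)
  then show "rinner (A x) y = 0" by (simp add: positive_op_selfadjoint[OF A] rinner_simps)
qed

text \<open>With V' the adjoint of V, the adjoint of V A is A V', and A V' V A = A A; uniqueness of
  the positive square root gives |V A| = A.\<close>

lemma polar_decomposition_compose:
  assumes V: "partial_isometry V" and A: "positive_op A" and null: "null_space A = null_space V"
  shows "op_abs (V \<circ> A) = A" "polar_decomposition (V \<circ> A) V"
proof -
  note bV = partial_isometryD[OF V] and bA = positive_opD(1)[OF A]
  note cancel = partial_isometry_cadjoint_cancel_positive[OF assms]
  have "cadjoint (V \<circ> A) = A \<circ> cadjoint V"
    by (rule cadjoint_eqI)
      (simp_all add: comp_def bounded_clinear_compose[OF bV bA] rinner_cadjoint[OF bV]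
        positive_op_selfadjoint[OF A, symmetric])
  then show abs: "op_abs (V \<circ> A) = A"
    unfolding op_abs_def by (intro op_sqrt_eqI[OF A]) (simp add: fun_eq_iff cancel)
  have "V (A x) = 0 \<longleftrightarrow> A x = 0" for x
    using cancel[of x] bounded_clinear_simps(4)[OF bV]
      bounded_clinear_simps(4)[OF bounded_clinear_cadjoint[OF bV]] by metis
  then show "polar_decomposition (V \<circ> A) V"
    using V null by (simp add: polar_decomposition_def abs null_space_def)
qed

text \<open>For w = V V' z - z, the identity V' V V' = V' gives V' w = 0, hence V w = 0 by the
  inclusion. The first makes w orthogonal to V V' z, the second to z = V' V z, so w is orthogonal to
  itself.\<close>

lemma partial_isometry_range_cancel:
  assumes V: "partial_isometry V" and null: "null_space (cadjoint V) \<subseteq> null_space V"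
    and z: "cadjoint V (V z) = z"
  shows "V (cadjoint V z) = z"
proof -
  note bV = partial_isometryD[OF V]
  note bV' = bounded_clinear_cadjoint[OF bV]
  define w where "w = V (cadjoint V z) - z"
  have "cadjoint V (V (cadjoint V z)) = cadjoint V z"
    by (rule partial_isometry_cadjoint_cancel[OF V]) (simp add: rinner_cadjoint_left[OF bV] rinner_simps)
  then have w: "cadjoint V w = 0" by (simp add: w_def bounded_clinear_simps[OF bV'])
  then have Vw: "V w = 0" using null by (auto simp: null_space_def)
  have "rinner w (V (cadjoint V z)) = 0"
    using w rinner_cadjoint_left[OF bV, of w "cadjoint V z"] by (simp add: rinner_simps)
  moreover have "rinner w z = 0"
    using Vw rinner_cadjoint[OF bV, of w "V z"] z by (simp add: rinner_simps)
  ultimately have "rinner w w = 0" by (subst (2) w_def) (simp add: rinner_simps)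
  then show ?thesis by (simp add: rinner_self w_def)
qed

section \<open>Iterated mean transforms\<close>

text \<open>The induction step: \<open>B\<close> inherits all that was assumed of \<open>A\<close>,
  so the same V is the polar factor of every iterate.\<close>

lemma mean_transform_compose:
  assumes V: "partial_isometry V" and A: "positive_op A" and null: "null_space A = null_space V"
    and null': "null_space (cadjoint V) \<subseteq> null_space V"
  defines "B \<equiv> \<lambda>x. (1/2) *\<^sub>R (A x + cadjoint V (A (V x)))"
  shows "mean_transform (V \<circ> A) = V \<circ> B" "positive_op B" "null_space B = null_space V"
proof -
  note bV = partial_isometryD[OF V] and bA = positive_opD(1)[OF A]
  note bV' = bounded_clinear_cadjoint[OF bV]
  note pol = polar_decomposition_compose[OF V A null]
  have bVA: "bounded_clinear (V \<circ> A)" by (simp add: comp_def bounded_clinear_compose[OF bV bA])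
  have "(THE W. polar_decomposition (V \<circ> A) W) = V"
    using pol(2) polar_decomposition_unique[OF bVA] by blast
  moreover have "V (cadjoint V (A x)) = A x" for x
    by (rule partial_isometry_range_cancel[OF V null'
          partial_isometry_cadjoint_cancel_positive[OF V A null]])
  ultimately show "mean_transform (V \<circ> A) = V \<circ> B"
    by (simp add: mean_transform_def pol(1) B_def fun_eq_iff bounded_clinear_simps[OF bV])
  have "positive_op (\<lambda>x. cadjoint V (A (V x)))"
    by (rule positive_opI)
      (simp_all add: bounded_clinear_compose[OF bV' bounded_clinear_compose[OF bA bV]] rinner_cadjoint[OF bV]
        rinner_cadjoint_left[OF bV] positive_op_selfadjoint[OF A, symmetric] positive_opD(2)[OF A])
  then show "positive_op B"
    unfolding B_def by (intro positive_op_scaleR positive_op_add A) auto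
  have "B x = 0 \<longleftrightarrow> V x = 0" for x
  proof
    assume "V x = 0"
    moreover then have "A x = 0" using null by (auto simp: null_space_def)
    ultimately show "B x = 0"
      by (simp add: B_def bounded_clinear_simps[OF bA] bounded_clinear_simps[OF bV'])
  next
    assume "B x = 0"
    then have "rinner (A x + cadjoint V (A (V x))) x = 0" by (simp add: B_def rinner_simps)
    then have "rinner (A x) x + rinner (A (V x)) (V x) = 0"
      by (simp add: rinner_simps rinner_cadjoint_left[OF bV])
    then have "rinner (A x) x = 0"
      using positive_opD(2)[OF A, of x] positive_opD(2)[OF A, of "V x"] by linarith
    then have "A x = 0" by (rule positive_op_eq_0[OF A])
    then show "V x = 0" using null by (auto simp: null_space_def)
  qed
  then show "null_space B = null_space V" by (simp add: null_space_def)
qed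

lemma binomial_sum_Suc:
  fixes f :: "nat \<Rightarrow> 'a::real_vector"
  shows "(\<Sum>j=0..Suc n. real (Suc n choose j) *\<^sub>R f j) =
    (\<Sum>j=0..n. real (n choose j) *\<^sub>R f j) + (\<Sum>j=0..n. real (n choose j) *\<^sub>R f (Suc j))"
proof -
  have "(\<Sum>j=0..Suc n. real (Suc n choose j) *\<^sub>R f j) =
      f 0 + (\<Sum>j=0..n. real (Suc n choose Suc j) *\<^sub>R f (Suc j))"
    by (simp only: sum.atLeast0_atMost_Suc_shift) simp
  also have "\<dots> = (f 0 + (\<Sum>j=0..n. real (n choose Suc j) *\<^sub>R f (Suc j))) +
      (\<Sum>j=0..n. real (n choose j) *\<^sub>R f (Suc j))"
    by (simp add: scaleR_add_left sum.distrib)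
  \<comment> \<open>After the index shift the sum runs to n + 1; its top coefficient, n choose n +
    1, is 0.\<close>
  also have "f 0 + (\<Sum>j=0..n. real (n choose Suc j) *\<^sub>R f (Suc j)) =
      (\<Sum>j=0..Suc n. real (n choose j) *\<^sub>R f j)"
    by (simp only: sum.atLeast0_atMost_Suc_shift) simp
  also have "\<dots> = (\<Sum>j=0..n. real (n choose j) *\<^sub>R f j)"
    by (simp add: binomial_eq_0)
  finally show ?thesis .
qed

theorem theorem2p15:
  fixes T V :: "'a::chilbert_space \<Rightarrow> 'a" and n :: nat
  assumes "bounded_clinear T"
    and "null_space (cadjoint T) \<subseteq> null_space T"
    and "polar_decomposition T V"
  shows "(mean_transform ^^ n) T =
    (\<lambda>x. (1 / 2 ^ n) *\<^sub>R
      V (\<Sum>j=0..n. real (n choose j) *\<^sub>R (cadjoint V ^^ j) (op_abs T ((V ^^ j) x))))"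
proof -
  have V: "partial_isometry V" and T: "T = V \<circ> op_abs T" and nullV: "null_space V = null_space T"
    using assms(3) by (auto simp: polar_decomposition_def)
  note bV = partial_isometryD[OF V]
  note bV' = bounded_clinear_cadjoint[OF bV]
  have null': "null_space (cadjoint V) \<subseteq> null_space V"
  proof
    fix w assume "w \<in> null_space (cadjoint V)"
    then have w: "cadjoint V w = 0" by (simp add: null_space_def)
    \<comment> \<open>T = V |T| moves onto the other argument: <x, T' w> = <|T| x, V' w> = 0. The
      kernel hypothesis then puts w in N(T) = N(V).\<close>
    have "cadjoint T w = 0"
    proof (rule rinner_eqI)
      fix x
      have "rinner x (cadjoint T w) = rinner (V (op_abs T x)) w"
        using T by (metis rinner_cadjoint[OF assms(1)] comp_apply)
      then show "rinner x (cadjoint T w) = rinner x 0"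
        by (simp add: rinner_cadjoint[OF bV, symmetric] w rinner_simps)
    qed
    then show "w \<in> null_space V" using assms(2) nullV by (auto simp: null_space_def)
  qed
  define A where "A n = (\<lambda>x. (1 / 2 ^ n) *\<^sub>R
      (\<Sum>j=0..n. real (n choose j) *\<^sub>R (cadjoint V ^^ j) (op_abs T ((V ^^ j) x))))" for n
  have A_Suc: "A (Suc n) = (\<lambda>x. (1/2) *\<^sub>R (A n x + cadjoint V (A n (V x))))" for n
  proof
    fix x
    \<comment> \<open>Conjugation by V raises each index by one, giving the second sum of
      \<open>binomial_sum_Suc\<close>.\<close>
    have "cadjoint V (A n (V x)) = (1 / 2 ^ n) *\<^sub>R
      (\<Sum>j=0..n. real (n choose j) *\<^sub>R (cadjoint V ^^ Suc j) (op_abs T ((V ^^ Suc j) x)))"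
      by (simp add: A_def bounded_clinear_simps[OF bV'] linear_sum[OF bounded_clinearD(2)[OF bV']]
          funpow_swap1)
    then show "A (Suc n) x = (1/2) *\<^sub>R (A n x + cadjoint V (A n (V x)))"
      unfolding A_def binomial_sum_Suc by (simp add: scaleR_add_right)
  qed
  have "(mean_transform ^^ n) T = V \<circ> A n \<and> positive_op (A n) \<and> null_space (A n) = null_space V"
  proof (induction n)
    case 0
    then show ?case
      using T op_abs_properties(1)[OF assms(1)] null_space_op_abs[OF assms(1)] nullV
      by (simp add: A_def)
  next
    case (Suc n)
    then have "(mean_transform ^^ Suc n) T = mean_transform (V \<circ> A n)"
      by (simp add: comp_def)
    then show ?case
      using Suc mean_transform_compose[OF V _ _ null', of "A n"] by (simp only: A_Suc simp_thms)
  qed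
  then show ?thesis by (simp add: A_def fun_eq_iff bounded_clinear_simps[OF bV])
qed

end
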